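(* Let $0<a<b<1$ and $$I(a,b):=\int_a^b\int_{-1/y}^{-b}\frac{\ln\left|\frac{(x-a)(x-b)(y^2+1)}{(y-a)(y-b)(x^2+1)}\right|}{(y-x)^2}\,dx\,dy.$$ Then $$I(a,b)=\mathcal L(z)+\mathcal L(\overline z)-\mathcal L(1/z)-\mathcal L(1/\overline z)=2\operatorname{Re}\{\mathcal L(z)-\mathcal L(1/z)\},\qquad z:=\frac{\frac{1-ab}{a+b}+i}{\frac{1-b^2}{2b}+i}.$$
   Context: $\mathcal L$ is the Rogers dilogarithm, defined holomorphically on $\mathbb C\setminus((-\infty,0]\cup[1,\infty))$ by $\mathcal L(z)=\operatorname{Li}_2(z)+\frac12\operatorname{Log}(z)\operatorname{Log}(1-z)$, where $\operatorname{Li}_2$ is the principal branch of the dilogarithm (cut along $[1,\infty)$) and $\operatorname{Log}$ the principal logarithm (cut along $(-\infty,0]$). $\ln$ is the natural logarithm of positive reals. *)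

theory Defs
  imports "HOL-Complex_Analysis.Complex_Analysis"
begin

text \<open>
  Principal branch of the dilogarithm on the complement of \<open>[1, \<infinity>)\<close>, which is star-shaped
  about \<open>0\<close>. The integrand has a removable singularity at \<open>0\<close>, so its value there is irrelevant.
\<close>
definition Li2 :: "complex \<Rightarrow> complex" where
  "Li2 z = - contour_integral (linepath 0 z) (\<lambda>w. Ln (1 - w) / w)"

text \<open>Only meaningful off the cuts \<open>(-\<infinity>, 0]\<close> and \<open>[1, \<infinity>)\<close>.\<close>
definition rogers_dilog :: "complex \<Rightarrow> complex" where
  "rogers_dilog z = Li2 z + Ln z * Ln (1 - z) / 2"

definition I_integrand :: "real \<Rightarrow> real \<Rightarrow> real \<Rightarrow> real \<Rightarrow> real" where
  "I_integrand a b x y =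
     ln \<bar>((x - a) * (x - b) * (y\<^sup>2 + 1)) / ((y - a) * (y - b) * (x\<^sup>2 + 1))\<bar> / (y - x)\<^sup>2"

definition I_inner :: "real \<Rightarrow> real \<Rightarrow> real \<Rightarrow> real" where
  "I_inner a b y = (LBINT x=ereal (- 1 / y)..ereal (- b). I_integrand a b x y)"

definition I_integral :: "real \<Rightarrow> real \<Rightarrow> real" where
  "I_integral a b = (LBINT y=ereal a..ereal b. I_inner a b y)"

end

theory Submission
  imports Defs "HOL-Real_Asymp.Real_Asymp"
begin

text \<open>
  Put \<open>a = tan \<alpha>\<close>, \<open>b = tan \<beta>\<close>, \<open>d = \<beta> - \<alpha>\<close>, \<open>s = \<alpha> + \<beta>\<close>. The measure \<open>dx dy / (y - x)\<^sup>2\<close> is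
  invariant under the Moebius group, and \<open>(x - a) (x - b) / (x\<^sup>2 + 1)\<close> becomes a product of two
  sines under \<open>x = tan \<xi>\<close>. Substituting \<open>y = tan (\<alpha> + t)\<close> and \<open>x = tan (\<alpha> - u)\<close> therefore gives
  \<open>I(a,b) = \<integral>\<^sub>0\<^sup>d \<integral>\<^sub>s\<^bsup>\<pi>/2-t\<^esup> k(u,t) du dt\<close> with
  \<open>k(u,t) = (ln (sin u sin (u + d)) - ln (sin t sin (d - t))) / sin\<^sup>2 (u + t)\<close>
  (lemmas \<open>I_integrand_tan\<close> and \<open>I_inner_tan\<close>).

  The kernel is invariant under \<open>(u,t) \<mapsto> (\<pi> - d - u, d - t)\<close>, an involution that fixes the abscissa
  \<open>m = (\<pi> - d) / 2\<close>. Hence the signed integral over the part between \<open>u = m\<close> and \<open>u = \<pi>/2 - t\<close> vanishes,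
  and only the rectangle \<open>s < u < m\<close>, \<open>0 < t < d\<close> remains. By Fubini's theorem one may integrate over
  \<open>t\<close> first (\<open>kern_double_integral\<close>), and the result \<open>D(u)\<close> is elementary, since \<open>k(u, \<cdot>)\<close> has an
  elementary antiderivative (\<open>kern_integral_fibre\<close>).

  On the other side, with \<open>d\<close> fixed, \<open>z = Z(s)\<close> for the point \<open>Z(u) = (sin (u + d) / sin u) e\<^bsup>-id\<^esup>\<close>,
  which moves along a ray through the origin. All the logarithms in the derivative of
  \<open>G(u) = 2 Re (L(Z(u)) - L(1/Z(u)))\<close> have explicit modulus and argument, and one finds \<open>G' = - D\<close>
  (\<open>has_real_derivative_dilog_difference\<close>). As \<open>|Z(m)| = 1\<close>, the points \<open>Z(m)\<close> and \<open>1/Z(m)\<close> are conjugate,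
  so \<open>G(m) = 0\<close>. Therefore \<open>I(a,b) = \<integral>\<^sub>s\<^sup>m D(u) du = G(s)\<close>.
\<close>

section \<open>The Rogers dilogarithm off the real axis\<close>

lemma Li2_has_field_derivative:
  assumes "z \<notin> of_real ` {1..}" "z \<noteq> 0"
  shows "(Li2 has_field_derivative - Ln (1 - z) / z) (at z)"
proof -
  define S :: "complex set" where "S = - of_real ` {1..}"
  define f :: "complex \<Rightarrow> complex" where "f w = (if w = 0 then -1 else Ln (1 - w) / w)" for w
  have open_S: "open S"
    unfolding S_def by (auto intro!: closed_slot_right open_Compl)
  have nonpos: "1 - w \<notin> \<real>\<^sub>\<le>\<^sub>0" if "w \<in> S" for w
  proof
    assume "1 - w \<in> \<real>\<^sub>\<le>\<^sub>0"
    then obtain x where "1 - w = of_real x" "x \<le> 0"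
      by (auto elim!: nonpos_Reals_cases)
    then have "w = of_real (1 - x)" "1 - x \<ge> 1"
      by (auto simp: algebra_simps)
    with that show False unfolding S_def by blast
  qed
  have segment: "closed_segment 0 w \<subseteq> S" if "w \<in> S" for w
  proof
    fix v assume "v \<in> closed_segment 0 w"
    then obtain t where t: "0 \<le> t" "t \<le> 1" "v = of_real t * w"
      by (auto simp: closed_segment_def scaleR_conv_of_real)
    show "v \<in> S"
    proof (rule ccontr)
      assume "v \<notin> S"
      then obtain c where c: "c \<ge> 1" "of_real t * w = of_real c"
        using t by (auto simp: S_def)
      then have "t > 0" using t by (cases "t = 0") auto
      then have "w = of_real (c / t)" "c / t \<ge> 1"
        using c t by (auto simp: field_simps)
      with that show False unfolding S_def by blast
    qed
  qed
  have "0 \<in> S" by (auto simp: S_def image_iff)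
  then have starlike_S: "starlike S"
    using segment unfolding starlike_def by blast
  have diff: "f field_differentiable at w" if "w \<in> S - {0}" for w
  proof -
    have "((\<lambda>v. Ln (1 - v) / v) has_field_derivative
             (-1 / (1 - w) * w - Ln (1 - w)) / (w * w)) (at w)"
      using that nonpos[of w] by (auto intro!: derivative_eq_intros simp: field_simps)
    moreover have "\<forall>\<^sub>F v in nhds w. (\<lambda>v. Ln (1 - v) / v) v = f v"
      using that eventually_nhds_in_open[of "-{0}" w] by (auto simp: f_def elim!: eventually_mono)
    ultimately show ?thesis
      unfolding field_differentiable_def by (metis DERIV_cong_ev)
  qed
  have "((\<lambda>v. Ln (1 - v)) has_field_derivative -1) (at 0)"
    by (auto intro!: derivative_eq_intros)
  then have "((\<lambda>v. Ln (1 - v) / v) \<longlongrightarrow> -1) (at 0)"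
    by (simp add: has_field_derivative_iff)
  then have "(f \<longlongrightarrow> -1) (at 0)"
    by (rule Lim_transform_eventually) (auto simp: f_def eventually_at_filter)
  then have "isCont f 0"
    by (simp add: isCont_def f_def)
  then have "isCont f w" if "w \<in> S" for w
    using diff[of w] that by (cases "w = 0") (auto intro: field_differentiable_imp_continuous_at)
  then have "continuous_on S f"
    by (simp add: continuous_at_imp_continuous_on)
  \<comment> \<open>The extended integrand \<open>f\<close> has a primitive on the slit plane \<open>S\<close>, which is star-shaped about \<open>0\<close>.\<close>
  from holomorphic_starlike_primitive[OF this starlike_S open_S, of "{0}"] diff
  obtain g where g: "\<And>w. w \<in> S \<Longrightarrow> (g has_field_derivative f w) (at w)"
    by auto
  have Li2_eq: "Li2 w = g 0 - g w" if "w \<in> S" for w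
  proof -
    have "(f has_contour_integral (g w - g 0)) (linepath 0 w)"
      using contour_integral_primitive[of S g f "linepath 0 w"] g segment[OF that]
      by (auto intro: has_field_derivative_at_within)
    then have "((\<lambda>t. f (linepath 0 w t) * (w - 0)) has_integral (g w - g 0)) {0..1}"
      unfolding has_contour_integral_linepath .
    \<comment> \<open>The integrands differ only at the initial point \<open>0\<close> of the path.\<close>
    then have "((\<lambda>t. Ln (1 - linepath 0 w t) / linepath 0 w t * (w - 0)) has_integral (g w - g 0)) {0..1}"
      by (rule has_integral_spike[of "{0}", rotated 2])
         (auto simp: f_def linepath_def)
    then have "((\<lambda>v. Ln (1 - v) / v) has_contour_integral (g w - g 0)) (linepath 0 w)"
      unfolding has_contour_integral_linepath .
    then show ?thesis
      unfolding Li2_def by (simp add: contour_integral_unique)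
  qed
  have zS: "z \<in> S" using assms by (auto simp: S_def)
  have "((\<lambda>w. g 0 - g w) has_field_derivative - Ln (1 - z) / z) (at z)"
    using g[OF zS] assms by (auto intro!: derivative_eq_intros simp: f_def)
  moreover have "\<forall>\<^sub>F w in nhds z. g 0 - g w = Li2 w"
    using eventually_nhds_in_open[OF open_S zS] by eventually_elim (simp add: Li2_eq)
  ultimately show ?thesis
    by (metis DERIV_cong_ev)
qed

lemma rogers_dilog_has_field_derivative:
  assumes "Im z \<noteq> 0"
  shows "(rogers_dilog has_field_derivative - (Ln (1 - z) / z + Ln z / (1 - z)) / 2) (at z)"
proof -
  have "z \<notin> of_real ` {1..}" "z \<noteq> 0" "z \<notin> \<real>\<^sub>\<le>\<^sub>0" "1 - z \<notin> \<real>\<^sub>\<le>\<^sub>0" "1 - z \<noteq> 0"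
    using assms by (auto simp: complex_nonpos_Reals_iff complex_eq_iff)
  then have "((\<lambda>z. Li2 z + Ln z * Ln (1 - z) / 2) has_field_derivative
      - (Ln (1 - z) / z + Ln z / (1 - z)) / 2) (at z)"
    by (auto intro!: derivative_eq_intros Li2_has_field_derivative simp: divide_simps)
       (simp add: algebra_simps)
  then show ?thesis
    unfolding rogers_dilog_def[abs_def] .
qed

lemma rogers_dilog_cnj:
  assumes "Im z \<noteq> 0"
  shows "rogers_dilog (cnj z) = cnj (rogers_dilog z)"
proof -
  have "linepath 0 (cnj z) = cnj \<circ> linepath 0 z"
    by (auto simp: linepath_def)
  then have "contour_integral (linepath 0 (cnj z)) (\<lambda>w. Ln (1 - w) / w)
      = cnj (contour_integral (linepath 0 z) (cnj \<circ> (\<lambda>w. Ln (1 - w) / w) \<circ> cnj))"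
    by (simp add: contour_integral_cnj)
  also have "contour_integral (linepath 0 z) (cnj \<circ> (\<lambda>w. Ln (1 - w) / w) \<circ> cnj)
      = contour_integral (linepath 0 z) (\<lambda>w. Ln (1 - w) / w)"
  proof (rule contour_integral_eq)
    fix w assume "w \<in> path_image (linepath 0 z)"
    then obtain t where t: "w = of_real t * z"
      by (auto simp: closed_segment_def scaleR_conv_of_real)
    have "1 - w \<notin> \<real>\<^sub>\<le>\<^sub>0"
      using assms by (auto simp: t complex_nonpos_Reals_iff)
    then show "(cnj \<circ> (\<lambda>w. Ln (1 - w) / w) \<circ> cnj) w = Ln (1 - w) / w"
      using arg_cong[OF cnj_Ln[of "1 - w"], of cnj] by simp
  qed
  finally have "Li2 (cnj z) = cnj (Li2 z)"
    unfolding Li2_def complex_cnj_minus by (rule arg_cong)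
  moreover have "z \<notin> \<real>\<^sub>\<le>\<^sub>0" "1 - z \<notin> \<real>\<^sub>\<le>\<^sub>0"
    using assms by (auto simp: complex_nonpos_Reals_iff)
  ultimately show ?thesis
    by (simp add: rogers_dilog_def cnj_Ln)
qed

section \<open>Variation of the dilogarithm along a ray\<close>

text \<open>
  For fixed \<open>d\<close> the points \<open>dilog_point d u\<close>, \<open>0 < u < \<pi> - d\<close>, fill the open ray of argument \<open>- d\<close>. The
  argument of the theorem is the point with \<open>d = arctan b - arctan a\<close>, \<open>u = arctan a + arctan b\<close>.
\<close>
definition dilog_point :: "real \<Rightarrow> real \<Rightarrow> complex" where
  "dilog_point d u = of_real (sin (u + d) / sin u) * cis (- d)"

text \<open>
  Closed form of the integral of the kernel \<open>kern d u\<close>, defined below, over \<open>{0<..<d}\<close>; it is also the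
  derivative of the dilogarithm expression along the ray, up to sign.
\<close>
definition fibre_integral :: "real \<Rightarrow> real \<Rightarrow> real" where
  "fibre_integral d u =
     2 * d + 2 * cot u * ln (sin (u + d) / sin d) - 2 * cot (u + d) * ln (sin u / sin d)"

lemma Ln_of_real_mult_cis:
  assumes "r > 0" "- pi < t" "t \<le> pi"
  shows "Ln (of_real r * cis t) = Complex (ln r) t"
  using assms by (intro Ln_unique) (auto simp: exp_eq_polar exp_of_real)

lemma inverse_dilog_point:
  "1 / dilog_point d u = of_real (sin u / sin (u + d)) * cis d"
  by (simp add: dilog_point_def divide_inverse mult.commute)

lemma has_real_derivative_Re_rogers_dilog_ray:
  fixes f :: "real \<Rightarrow> real" and c :: complex
  assumes f: "(f has_real_derivative f') (at x)" and Z: "Z = of_real (f x) * c" "Im Z \<noteq> 0"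
  shows "((\<lambda>x. Re (rogers_dilog (of_real (f x) * c))) has_real_derivative
      Re (of_real f' * c * (- (Ln (1 - Z) / Z + Ln Z / (1 - Z)) / 2))) (at x)"
proof -
  have "((\<lambda>x. of_real (f x) * c) has_vector_derivative of_real f' * c) (at x)"
    using f by (intro has_vector_derivative_mult_left has_vector_derivative_of_real)
      (simp add: has_real_derivative_iff_has_vector_derivative)
  moreover have "(rogers_dilog has_field_derivative - (Ln (1 - Z) / Z + Ln Z / (1 - Z)) / 2)
      (at (of_real (f x) * c))"
    using rogers_dilog_has_field_derivative Z by simp
  ultimately have "((rogers_dilog \<circ> (\<lambda>x. of_real (f x) * c)) has_vector_derivative
      of_real f' * c * (- (Ln (1 - Z) / Z + Ln Z / (1 - Z)) / 2)) (at x)"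
    by (rule field_vector_diff_chain_at)
  from bounded_linear.has_vector_derivative[OF bounded_linear_Re this] show ?thesis
    by (simp add: has_real_derivative_iff_has_vector_derivative o_def)
qed

text \<open>
  The points \<open>Z\<close>, \<open>1 - Z\<close>, \<open>W = 1/Z\<close> and \<open>1 - W\<close> all have moduli that are quotients of sines and
  arguments that are affine in \<open>u\<close>, because \<open>0\<close>, \<open>1\<close>, \<open>Z\<close> form a triangle with angles \<open>d\<close>, \<open>u\<close> and
  \<open>\<pi> - d - u\<close>. This makes the derivative elementary.
\<close>
lemma has_real_derivative_dilog_difference:
  assumes "0 < d" "0 < u" "u + d < pi"
  shows "((\<lambda>u. 2 * Re (rogers_dilog (dilog_point d u) - rogers_dilog (1 / dilog_point d u)))
           has_real_derivative - fibre_integral d u) (at u)"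
proof -
  define su where "su = sin u"
  define sv where "sv = sin (u + d)"
  define sd where "sd = sin d"
  define cu where "cu = cos u"
  define cv where "cv = cos (u + d)"
  have pos: "su > 0" "sv > 0" "sd > 0"
    using assms by (auto simp: su_def sv_def sd_def intro!: sin_gt_zero)
  have cos_d: "cos d = cv * cu + sv * su"
    unfolding cv_def cu_def sv_def su_def using cos_diff[of "u + d" u] by simp
  have sin_d: "sd = sv * cu - cv * su"
    unfolding cv_def cu_def sv_def su_def sd_def using sin_diff[of "u + d" u] by simp
  have sq: "cu\<^sup>2 + su\<^sup>2 = 1" "cv\<^sup>2 + sv\<^sup>2 = 1"
    by (simp_all add: cu_def cv_def su_def sv_def)
  have sq1: "su - sv * cos d = - sd * cv" and sq2: "sv - su * cos d = sd * cu"
    using sq unfolding cos_d sin_d by algebra+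
  define Z where "Z = of_real (sv / su) * cis (- d)"
  define W where "W = of_real (su / sv) * cis d"
  have Im: "Im Z \<noteq> 0" "Im W \<noteq> 0"
    using pos by (auto simp: Z_def W_def sd_def)
  have one_minus_Z: "1 - Z = of_real (sd / su) * cis (pi - (u + d))"
  proof (rule complex_eqI)
    have "Re (1 - Z) = 1 - sv / su * cos d" by (simp add: Z_def)
    also have "\<dots> = (su - sv * cos d) / su" using pos by (simp add: diff_divide_distrib)
    also have "\<dots> = sd / su * (- cv)" unfolding sq1 by simp
    finally show "Re (1 - Z) = Re (of_real (sd / su) * cis (pi - (u + d)))"
      by (simp add: cv_def)
    have "Im (1 - Z) = sd / su * sv" by (simp add: Z_def sd_def)
    then show "Im (1 - Z) = Im (of_real (sd / su) * cis (pi - (u + d)))"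
      by (simp add: sv_def)
  qed
  have one_minus_W: "1 - W = of_real (sd / sv) * cis (- u)"
  proof (rule complex_eqI)
    have "Re (1 - W) = 1 - su / sv * cos d" by (simp add: W_def)
    also have "\<dots> = (sv - su * cos d) / sv" using pos by (simp add: diff_divide_distrib)
    also have "\<dots> = sd / sv * cu" unfolding sq2 by simp
    finally show "Re (1 - W) = Re (of_real (sd / sv) * cis (- u))"
      by (simp add: cu_def)
    have "Im (1 - W) = - (sd / sv * su)" by (simp add: W_def sd_def)
    then show "Im (1 - W) = Im (of_real (sd / sv) * cis (- u))"
      by (simp add: su_def)
  qed
  have Ln_eqs: "Ln Z = Complex (ln (sv / su)) (- d)" "Ln W = Complex (ln (su / sv)) d"
    "Ln (1 - Z) = Complex (ln (sd / su)) (pi - (u + d))" "Ln (1 - W) = Complex (ln (sd / sv)) (- u)"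
    unfolding one_minus_Z one_minus_W unfolding Z_def W_def
    by (rule Ln_of_real_mult_cis; use pos assms in \<open>simp\<close>)+

  have distrib: "q * c * (- (A / X + B / Y) / 2) = - q * (c / X * A + c / Y * B) / 2"
    for q c A B X Y :: complex
    by (simp add: ring_distribs mult.assoc)
  have d_Z: "((\<lambda>u. sin (u + d) / sin u) has_real_derivative - sd / su\<^sup>2) (at u)"
    using pos unfolding su_def sin_d sv_def cu_def cv_def
    by (auto intro!: derivative_eq_intros simp: power2_eq_square field_simps)
  have d_W: "((\<lambda>u. sin u / sin (u + d)) has_real_derivative sd / sv\<^sup>2) (at u)"
    using pos unfolding sv_def sin_d su_def cu_def cv_def
    by (auto intro!: derivative_eq_intros simp: power2_eq_square field_simps)
  have "((\<lambda>u. Re (rogers_dilog (dilog_point d u))) has_real_derivative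
      Re (of_real (- sd / su\<^sup>2) * cis (- d) * (- (Ln (1 - Z) / Z + Ln Z / (1 - Z)) / 2))) (at u)"
    unfolding dilog_point_def
    by (rule has_real_derivative_Re_rogers_dilog_ray[OF d_Z _ Im(1)]) (simp add: Z_def su_def sv_def)
  also have "of_real (- sd / su\<^sup>2) * cis (- d) * (- (Ln (1 - Z) / Z + Ln Z / (1 - Z)) / 2) =
      (of_real (sd / (su * sv)) * Ln (1 - Z) - of_real (1 / su) * cis u * Ln Z) / 2"
  proof -
    have e1: "cis (- d) / Z = of_real (su / sv)"
      using pos by (simp add: Z_def)
    have e2: "cis (- d) / (1 - Z) = - of_real (su / sd) * cis u"
    proof -
      have "cis u * cis (pi - (u + d)) = - cis (- d)"
        by (simp add: cis_mult minus_cis algebra_simps)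
      moreover have "- of_real (su / sd) * cis u * (1 - Z) =
          - (of_real (su / sd) * of_real (sd / su)) * (cis u * cis (pi - (u + d)))"
        unfolding one_minus_Z by (simp only: mult_ac mult_minus_left mult_minus_right)
      ultimately have "- of_real (su / sd) * cis u * (1 - Z) = cis (- d)"
        using pos by simp
      moreover have "1 - Z \<noteq> 0" using Im by auto
      ultimately show ?thesis by (metis nonzero_mult_div_cancel_right)
    qed
    have coeff: "sd / su\<^sup>2 * (su / sv) = sd / (su * sv)" "sd / su\<^sup>2 * (su / sd) = 1 / su"
      using pos by (simp_all add: power2_eq_square)
    show ?thesis
      unfolding distrib e1 e2 coeff[symmetric] by (simp add: ring_distribs mult.assoc)
  qed
  also have "Re \<dots> = (sd / (su * sv) * ln (sd / su) - (cu * ln (sv / su) + d * su) / su) / 2"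
    using pos by (simp add: Ln_eqs cu_def su_def field_simps)
  finally have deriv_Z: "((\<lambda>u. Re (rogers_dilog (dilog_point d u))) has_real_derivative
    (sd / (su * sv) * ln (sd / su) - (cu * ln (sv / su) + d * su) / su) / 2) (at u)" .

  have "((\<lambda>u. Re (rogers_dilog (1 / dilog_point d u))) has_real_derivative
      Re (of_real (sd / sv\<^sup>2) * cis d * (- (Ln (1 - W) / W + Ln W / (1 - W)) / 2))) (at u)"
    unfolding inverse_dilog_point
    by (rule has_real_derivative_Re_rogers_dilog_ray[OF d_W _ Im(2)]) (simp add: W_def su_def sv_def)
  also have "of_real (sd / sv\<^sup>2) * cis d * (- (Ln (1 - W) / W + Ln W / (1 - W)) / 2) =
      - (of_real (sd / (su * sv)) * Ln (1 - W) + of_real (1 / sv) * cis (u + d) * Ln W) / 2"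
  proof -
    have e1: "cis d / W = of_real (sv / su)"
      using pos by (simp add: W_def)
    have e2: "cis d / (1 - W) = of_real (sv / sd) * cis (u + d)"
    proof -
      have "cis (u + d) * cis (- u) = cis d"
        by (simp add: cis_mult)
      moreover have "of_real (sv / sd) * cis (u + d) * (1 - W) =
          (of_real (sv / sd) * of_real (sd / sv)) * (cis (u + d) * cis (- u))"
        unfolding one_minus_W by (simp only: mult_ac)
      ultimately have "of_real (sv / sd) * cis (u + d) * (1 - W) = cis d"
        using pos by simp
      moreover have "1 - W \<noteq> 0" using Im by auto
      ultimately show ?thesis by (metis nonzero_mult_div_cancel_right)
    qed
    have coeff: "sd / sv\<^sup>2 * (sv / su) = sd / (su * sv)" "sd / sv\<^sup>2 * (sv / sd) = 1 / sv"
      using pos by (simp_all add: power2_eq_square)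
    show ?thesis
      unfolding distrib e1 e2 coeff[symmetric] by (simp add: ring_distribs mult.assoc)
  qed
  also have "Re \<dots> = - (sd / (su * sv) * ln (sd / sv) + (cv * ln (su / sv) - d * sv) / sv) / 2"
    using pos by (simp add: Ln_eqs cv_def sv_def field_simps)
  finally have deriv_W: "((\<lambda>u. Re (rogers_dilog (1 / dilog_point d u))) has_real_derivative
    - (sd / (su * sv) * ln (sd / sv) + (cv * ln (su / sv) - d * sv) / sv) / 2) (at u)" .

  have cots: "cot u = cu / su" "cot (u + d) = cv / sv"
    by (simp_all add: cot_def cu_def su_def cv_def sv_def)
  \<comment> \<open>The identity \<open>sin d / (sin u sin (u + d)) = cot u - cot (u + d)\<close> brings the sum into closed form.\<close>
  have sd_cot: "sd / (su * sv) = cu / su - cv / sv"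
    using pos by (simp add: sin_d field_simps)
  have "2 * ((sd / (su * sv) * ln (sd / su) - (cu * ln (sv / su) + d * su) / su) / 2
      - - (sd / (su * sv) * ln (sd / sv) + (cv * ln (su / sv) - d * sv) / sv) / 2)
      = - fibre_integral d u"
    unfolding fibre_integral_def cots sd_cot
      su_def[symmetric] sv_def[symmetric] sd_def[symmetric]
    using pos by (simp add: ln_div field_simps)
  then show ?thesis
    using DERIV_cmult[OF DERIV_diff[OF deriv_Z deriv_W], of 2] by simp
qed

section \<open>Substitution rules and logarithmic singularities\<close>

text \<open>
  Change of variables for Lebesgue integrals over Borel sets. The function \<open>f\<close>
  need not be continuous, \<open>g\<close> may be decreasing, and integrability is carried along.
\<close>
lemma set_integral_substitution_inj:
  fixes f g g' :: "real \<Rightarrow> real"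
  assumes S: "S \<in> sets borel" and T: "T \<in> sets borel" "g ` S = T" and inj: "inj_on g S"
    and deriv: "\<And>x. x \<in> S \<Longrightarrow> (g has_real_derivative g' x) (at x)"
    and [measurable]: "g \<in> borel_measurable borel" "g' \<in> borel_measurable borel"
    and f: "set_integrable lborel T f"
  shows "set_integrable lborel S (\<lambda>x. \<bar>g' x\<bar> * f (g x))"
    and "(LINT x:S|lborel. \<bar>g' x\<bar> * f (g x)) = (LINT x:T|lborel. f x)"
proof -
  have f_meas [measurable]: "(\<lambda>x. indicator T x *\<^sub>R f x) \<in> borel_measurable lborel"
    using f unfolding set_integrable_def by (rule borel_measurable_integrable)
  have "(\<lambda>x. indicator S x * (\<bar>g' x\<bar> * (indicator T (g x) *\<^sub>R f (g x)))) \<in> borel_measurable borel"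
    using f_meas S by measurable
  also have "(\<lambda>x. indicator S x * (\<bar>g' x\<bar> * (indicator T (g x) *\<^sub>R f (g x)))) =
      (\<lambda>x. indicator S x *\<^sub>R (\<bar>g' x\<bar> * f (g x)))"
    using T by (auto simp: fun_eq_iff indicator_def)
  finally have meas: "(\<lambda>x. indicator S x *\<^sub>R (\<bar>g' x\<bar> * f (g x))) \<in> borel_measurable lborel"
    by simp
  have f': "f absolutely_integrable_on T"
    using f f_meas unfolding set_integrable_def by (simp add: integrable_completion)
  have "(\<lambda>x. \<bar>g' x\<bar> * f (g x)) absolutely_integrable_on S \<and>
        integral S (\<lambda>x. \<bar>g' x\<bar> * f (g x)) = integral T f"
    using has_absolute_integral_change_of_variables_1'[of S g g' f "integral T f"] S inj f' T
      has_field_derivative_at_within[OF deriv] by auto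
  moreover from this show int: "set_integrable lborel S (\<lambda>x. \<bar>g' x\<bar> * f (g x))"
    using meas unfolding set_integrable_def by (simp add: integrable_completion)
  ultimately show "(LINT x:S|lborel. \<bar>g' x\<bar> * f (g x)) = (LINT x:T|lborel. f x)"
    using f by (simp add: set_borel_integral_eq_integral)
qed

text \<open>No assumption on the order of \<open>a\<close> and \<open>b\<close>, and none on \<open>f\<close>, is needed.\<close>
lemma interval_integral_minus_argument:
  fixes f :: "real \<Rightarrow> real" and a b c :: real
  shows "(LBINT x=a..b. f (c - x)) = (LBINT x=c-b..c-a. f x)"
proof -
  have le: "(LBINT x=a..b. f (c - x)) = (LBINT x=c-b..c-a. f x)" if "a \<le> b" for a b :: real
  proof -
    have "(LBINT x=c-b..c-a. f x) = (\<integral>x. indicator {c-b<..<c-a} x *\<^sub>R f x \<partial>lborel)"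
      using that by (simp add: interval_lebesgue_integral_def set_lebesgue_integral_def)
    also have "\<dots> = (\<integral>x. indicator {c-b<..<c-a} (c - x) *\<^sub>R f (c - x) \<partial>lborel)"
      by (subst lborel_integral_real_affine[of "-1" _ c]) simp_all
    also have "(\<lambda>x. indicator {c-b<..<c-a} (c - x) *\<^sub>R f (c - x)) =
        (\<lambda>x. indicator {a<..<b} x *\<^sub>R f (c - x))"
      by (auto simp: fun_eq_iff indicator_def)
    finally show ?thesis
      using that by (simp add: interval_lebesgue_integral_def set_lebesgue_integral_def)
  qed
  show ?thesis
  proof (cases "a \<le> b")
    case False
    then show ?thesis
      using le[of b a] by (simp add: interval_integral_endpoints_reverse[of a b]
          interval_integral_endpoints_reverse[of "c-b" "c-a"])
  qed (rule le)
qed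

text \<open>The value of \<open>ln 0\<close> does not matter, as it is multiplied by \<open>0\<close>.\<close>
lemma continuous_on_mult_ln: "continuous_on {0..} (\<lambda>x::real. x * ln x)"
proof -
  have "((\<lambda>x::real. x * ln x) \<longlongrightarrow> 0) (at_right 0)"
    by real_asymp
  then have "continuous (at x within {0..}) (\<lambda>x. x * ln x)" if "x \<ge> 0" for x :: real
    using that
    by (cases "x = 0") (auto simp: continuous_within at_within_Ici_at_right intro!: tendsto_intros)
  then show ?thesis
    by (simp add: continuous_on_eq_continuous_within)
qed

lemma set_integrable_const_Ioo: "set_integrable lborel {a<..<b::real} (\<lambda>_. c::real)"
  by (rule set_integrable_subset[OF borel_integrable_atLeastAtMost'[of a b]]) auto

text \<open>
  The bound \<open>d \<le> 1\<close> keeps \<open>- ln t\<close> nonnegative on the interval, so that its antiderivative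
  \<open>t - t ln t\<close> yields absolute integrability; \<open>ln (sin t)\<close> is then dominated by means of
  \<open>sin t \<ge> t / 2\<close>.
\<close>
lemma set_integrable_ln_sin:
  fixes d :: real
  assumes "0 < d" "d \<le> 1"
  shows "set_integrable lborel {0<..<d} (\<lambda>t. ln (sin t))"
proof -
  have "((\<lambda>t. - ln t) has_integral (d - d * ln d) - (0 - 0 * ln 0)) {0..d}"
    using assms
    by (intro fundamental_theorem_of_calculus_interior[where f = "\<lambda>t. t - t * ln t"])
       (auto intro!: continuous_intros continuous_on_subset[OF continuous_on_mult_ln] derivative_eq_intros
         simp flip: has_real_derivative_iff_has_vector_derivative)
  moreover have "0 \<le> - ln t" if "t \<in> {0..d}" for t
    using that assms by (cases "t = 0") auto
  ultimately have "(\<lambda>t. - ln t) absolutely_integrable_on {0..d}"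
    by (intro nonnegative_absolutely_integrable_1) (auto simp: integrable_on_def)
  then have "set_integrable lborel {0..d} (\<lambda>t. - ln t)"
    unfolding set_integrable_def by (simp add: integrable_completion)
  then have "set_integrable lborel {0<..<d} (\<lambda>t. - ln t)"
    by (rule set_integrable_subset) auto
  then have "set_integrable lborel {0<..<d} (\<lambda>t. - ln t + ln 2)"
    by (rule set_integral_add(1)) (rule set_integrable_const_Ioo)
  then show ?thesis
  proof (rule set_integrable_bound)
    show "AE t in lborel. t \<in> {0<..<d} \<longrightarrow> norm (ln (sin t)) \<le> norm (- ln t + ln 2)"
    proof (intro AE_I2 impI)
      fix t assume t: "t \<in> {0<..<d}"
      have "sin 0 - 0 / 2 \<le> sin t - t / 2"
      proof (rule DERIV_nonneg_imp_nondecreasing[where f = "\<lambda>x. sin x - x / 2"])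
        fix x assume x: "0 \<le> x" "x \<le> t"
        then have "cos (pi / 3) \<le> cos x"
          using t assms pi_gt3 by (intro cos_monotone_0_pi_le) auto
        then show "\<exists>y. ((\<lambda>x. sin x - x / 2) has_real_derivative y) (at x) \<and> 0 \<le> y"
          by (intro exI[of _ "cos x - 1 / 2"]) (auto intro!: derivative_eq_intros simp: cos_60)
      qed (use t in auto)
      then have "t / 2 \<le> sin t" by simp
      moreover have "ln (t / 2) \<le> ln (sin t)"
        using calculation(1) t by (subst ln_le_cancel_iff) auto
      moreover have "ln (sin t) \<le> 0"
        using calculation(1) t by (subst ln_le_zero_iff) auto
      ultimately show "norm (ln (sin t)) \<le> norm (- ln t + ln 2)"
        using t by (simp add: ln_div)
    qed
  qed (simp add: set_borel_measurable_def)
qed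

lemma image_minus_Ioo: "(\<lambda>t. d - t) ` {0<..<d} = {0<..<d::real}"
proof safe
  fix x assume "x \<in> {0<..<d}"
  then show "x \<in> (\<lambda>t. d - t) ` {0<..<d}"
    by (intro image_eqI[of _ _ "d - x"]) auto
qed auto

lemma set_integrable_ln_sin_minus:
  fixes d :: real
  assumes "0 < d" "d \<le> 1"
  shows "set_integrable lborel {0<..<d} (\<lambda>t. ln (sin (d - t)))"
proof -
  have "((\<lambda>t. d - t) has_real_derivative -1) (at x)" for x
    by (auto intro!: derivative_eq_intros)
  then show ?thesis
    using set_integral_substitution_inj(1)[OF _ _ image_minus_Ioo _ _ _ _ set_integrable_ln_sin[OF assms],
      of "\<lambda>_. -1"] by (simp add: inj_on_def)
qed

section \<open>The kernel in angular coordinates\<close>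

text \<open>
  The integrand \<open>I_integrand a b x y\<close> in the coordinates \<open>x = tan (arctan a - u)\<close>,
  \<open>y = tan (arctan a + t)\<close>, with the Jacobian included and \<open>d = arctan b - arctan a\<close>. It is meant for
  \<open>0 < u < \<pi> - d\<close> and \<open>0 < t < d\<close>, where every sine that occurs is positive.
\<close>
definition kern :: "real \<Rightarrow> real \<Rightarrow> real \<Rightarrow> real" where
  "kern d u t = (ln (sin u * sin (u + d)) - ln (sin t * sin (d - t))) / (sin (u + t))\<^sup>2"

lemma kern_reflect: "kern d (pi - d - u) (d - t) = kern d u t"
  using sin_pi_minus[of "u + d"] sin_pi_minus[of u] sin_pi_minus[of "u + t"]
  by (simp add: kern_def algebra_simps)

lemma kern_measurable [measurable]: "(\<lambda>p. kern d (f p) (g p)) \<in> borel_measurable M"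
  if [measurable]: "f \<in> borel_measurable M" "g \<in> borel_measurable M"
  unfolding kern_def by measurable

lemma continuous_on_kern:
  assumes "0 < d" "d < pi" "0 < t" "t < d" "\<And>u. u \<in> U \<Longrightarrow> 0 < u \<and> u + d < pi"
  shows "continuous_on U (\<lambda>u. kern d u t)"
proof -
  have "sin u > 0" "sin (u + d) > 0" "sin (u + t) > 0" if "u \<in> U" for u
    using assms(1-4) assms(5)[OF that] by (auto intro!: sin_gt_zero)
  then show ?thesis
    unfolding kern_def by (intro continuous_intros) (auto simp: less_imp_neq[symmetric] dest: less_imp_neq[symmetric])
qed

text \<open>
  On \<open>s \<le> u \<le> c\<close> the arguments \<open>u\<close>, \<open>u + d\<close> and \<open>u + t\<close> stay in the compact subinterval \<open>{s..c + d}\<close> of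
  \<open>{0<..<\<pi>}\<close>, so the only singularities of the kernel are the logarithmic ones at \<open>t = 0\<close> and \<open>t = d\<close>.
\<close>
lemma kern_bound:
  assumes "0 < d" "0 < s" "s \<le> c" "c + d < pi"
  obtains C where "\<And>u t. s \<le> u \<Longrightarrow> u \<le> c \<Longrightarrow> 0 < t \<Longrightarrow> t < d \<Longrightarrow>
    \<bar>kern d u t\<bar> \<le> C * (1 + \<bar>ln (sin t)\<bar> + \<bar>ln (sin (d - t))\<bar>)"
proof -
  have "\<exists>x\<in>{s..c+d}. \<forall>y\<in>{s..c+d}. sin x \<le> sin y"
    using assms by (intro continuous_attains_inf) (auto intro!: continuous_intros)
  then obtain x where x: "x \<in> {s..c+d}" "\<And>y. y \<in> {s..c+d} \<Longrightarrow> sin x \<le> sin y"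
    by blast
  define m where "m = sin x"
  have m: "m > 0" using x(1) assms unfolding m_def by (intro sin_gt_zero) auto
  have ge_m: "m \<le> sin y" if "s \<le> y" "y \<le> c + d" for y
    using x(2) that by (simp add: m_def)
  have ln_le: "\<bar>ln (sin y)\<bar> \<le> \<bar>ln m\<bar>" if "s \<le> y" "y \<le> c + d" for y
  proof -
    have "ln m \<le> ln (sin y)" using ge_m[OF that] m by simp
    moreover have "ln (sin y) \<le> 0" using ge_m[OF that] m by (subst ln_le_zero_iff) auto
    ultimately show ?thesis by simp
  qed
  define C where "C = (2 * \<bar>ln m\<bar> + 1) / m\<^sup>2"
  have "\<bar>kern d u t\<bar> \<le> C * (1 + \<bar>ln (sin t)\<bar> + \<bar>ln (sin (d - t))\<bar>)"
    if "s \<le> u" "u \<le> c" "0 < t" "t < d" for u t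
  proof -
    have pos: "sin u > 0" "sin (u + d) > 0" "sin (u + t) > 0" "sin t > 0" "sin (d - t) > 0"
      using that assms by (auto intro!: sin_gt_zero)
    have "\<bar>ln (sin u * sin (u + d)) - ln (sin t * sin (d - t))\<bar>
        \<le> 2 * \<bar>ln m\<bar> + \<bar>ln (sin t)\<bar> + \<bar>ln (sin (d - t))\<bar>"
    proof -
      have "ln (sin u * sin (u + d)) = ln (sin u) + ln (sin (u + d))"
        and "ln (sin t * sin (d - t)) = ln (sin t) + ln (sin (d - t))"
        using pos by (simp_all add: ln_mult)
      moreover have "\<bar>ln (sin u)\<bar> \<le> \<bar>ln m\<bar>" "\<bar>ln (sin (u + d))\<bar> \<le> \<bar>ln m\<bar>"
        using ln_le[of u] ln_le[of "u + d"] that assms by auto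
      ultimately show ?thesis by linarith
    qed
    also have "\<dots> \<le> (2 * \<bar>ln m\<bar> + 1) * (1 + \<bar>ln (sin t)\<bar> + \<bar>ln (sin (d - t))\<bar>)"
      by (simp add: algebra_simps)
    finally have "\<bar>ln (sin u * sin (u + d)) - ln (sin t * sin (d - t))\<bar> / (sin (u + t))\<^sup>2
        \<le> (2 * \<bar>ln m\<bar> + 1) * (1 + \<bar>ln (sin t)\<bar> + \<bar>ln (sin (d - t))\<bar>) / m\<^sup>2"
      using m ge_m[of "u + t"] that assms pos by (intro frac_le power_mono) auto
    then show ?thesis
      by (simp add: kern_def C_def)
  qed
  then show thesis by (rule that)
qed

lemma kern_majorant_integrable:
  fixes d :: real
  assumes "0 < d" "d \<le> 1"
  shows "set_integrable lborel {0<..<d} (\<lambda>t. C * (1 + \<bar>ln (sin t)\<bar> + \<bar>ln (sin (d - t))\<bar>))"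
proof -
  have "set_integrable lborel {0<..<d} (\<lambda>t. 1 + \<bar>ln (sin t)\<bar>)"
    by (rule set_integral_add(1)) (intro set_integrable_const_Ioo set_integrable_abs set_integrable_ln_sin assms)+
  then have "set_integrable lborel {0<..<d} (\<lambda>t. 1 + \<bar>ln (sin t)\<bar> + \<bar>ln (sin (d - t))\<bar>)"
    by (rule set_integral_add(1)) (intro set_integrable_abs set_integrable_ln_sin_minus assms)
  then show ?thesis
    by simp
qed

text \<open>
  Integration by parts, with \<open>- cot (u + t)\<close> as antiderivative of \<open>1 / sin\<^sup>2 (u + t)\<close>, produces the
  antiderivative \<open>F\<close> of the proof. Its terms are grouped so that \<open>ln (sin t)\<close> and \<open>ln (sin (d - t))\<close> occur
  only multiplied by \<open>sin t\<close> and \<open>sin (d - t)\<close>, which makes \<open>F\<close> continuous on the closed interval.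
\<close>
lemma kern_integral_fibre:
  assumes "0 < d" "d \<le> 1" "0 < u" "u + d < pi"
  shows "(LINT t:{0<..<d}|lborel. kern d u t) = fibre_integral d u"
proof -
  obtain C where C: "\<And>t. 0 < t \<Longrightarrow> t < d \<Longrightarrow>
    \<bar>kern d u t\<bar> \<le> C * (1 + \<bar>ln (sin t)\<bar> + \<bar>ln (sin (d - t))\<bar>)"
    using kern_bound[of d u u] assms by (metis order_refl)
  have int: "set_integrable lborel {0<..<d} (kern d u)"
    using kern_majorant_integrable[OF assms(1,2), of C]
  proof (rule set_integrable_bound)
    show "AE t in lborel. t \<in> {0<..<d} \<longrightarrow>
        norm (kern d u t) \<le> norm (C * (1 + \<bar>ln (sin t)\<bar> + \<bar>ln (sin (d - t))\<bar>))"
      using C by (auto intro!: AE_I2 intro: order_trans[OF _ abs_ge_self])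
  qed (simp add: set_borel_measurable_def)
  define su cu sv cv where "su = sin u" and "cu = cos u" and "sv = sin (u + d)" and "cv = cos (u + d)"
  define L k where "L = ln (su * sv)" and "k = cu / su + cv / sv"
  define F where "F t = - L * (cos (u + t) / sin (u + t)) + 2 * t + k * ln (sin (u + t))
    - sin t * ln (sin t) / sin (u + t) / su + sin (d - t) * ln (sin (d - t)) / sin (u + t) / sv" for t
  have spos: "su > 0" "sv > 0" "sin d > 0"
    using assms pi_gt3 by (auto simp: su_def sv_def intro!: sin_gt_zero)
  have ppos: "sin (u + t) > 0" if "0 \<le> t" "t \<le> d" for t
    using that assms by (auto intro!: sin_gt_zero)
  have ppos_ne: "sin (u + t) = 0 \<Longrightarrow> 0 \<le> t \<Longrightarrow> t \<le> d \<Longrightarrow> False" for t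
    using ppos[of t] by simp
  have "(kern d u has_integral F d - F 0) {0..d}"
  proof (rule fundamental_theorem_of_calculus_interior)
    have nonneg: "sin t \<ge> 0" if "0 \<le> t" "t \<le> d" for t
      using that assms pi_gt3 by (auto intro!: sin_ge_zero)
    have "continuous_on {0..d} (\<lambda>t. sin t * ln (sin t))"
      using nonneg by (intro continuous_on_compose2[OF continuous_on_mult_ln]) (auto intro!: continuous_intros)
    moreover have "continuous_on {0..d} (\<lambda>t. sin (d - t) * ln (sin (d - t)))"
      using nonneg by (intro continuous_on_compose2[OF continuous_on_mult_ln]) (auto intro!: continuous_intros)
    moreover have "continuous_on {0..d} (\<lambda>t. - L * (cos (u + t) / sin (u + t)) + 2 * t
        + k * ln (sin (u + t)) - h1 t / sin (u + t) / su + h2 t / sin (u + t) / sv)"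
      if "continuous_on {0..d} h1" "continuous_on {0..d} h2" for h1 h2
      using that spos by (intro continuous_intros) (auto dest: ppos_ne)
    ultimately show "continuous_on {0..d} F"
      unfolding F_def[abs_def] by blast
  next
    fix t assume t: "t \<in> {0<..<d}"
    define p c where "p = sin (u + t)" and "c = cos (u + t)"
    have p: "p > 0" using ppos[of t] t by (simp add: p_def)
    have st: "sin t > 0" "sin (d - t) > 0"
      using t assms pi_gt3 by (auto intro!: sin_gt_zero)
    have trig: "sin t = p * cu - c * su" "cos t = c * cu + p * su"
      "sin (d - t) = sv * c - cv * p" "cos (d - t) = cv * c + sv * p"
      using sin_diff[of "u + t" u] cos_diff[of "u + t" u] sin_diff[of "u + d" "u + t"] cos_diff[of "u + d" "u + t"]
      by (simp_all add: p_def c_def su_def cu_def sv_def cv_def)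
    have sq: "cu\<^sup>2 + su\<^sup>2 = 1" "cv\<^sup>2 + sv\<^sup>2 = 1" "c\<^sup>2 + p\<^sup>2 = 1"
      by (simp_all add: cu_def su_def cv_def sv_def c_def p_def)
    define l1 l2 where "l1 = ln (sin t)" and "l2 = ln (sin (d - t))"
    have d_sin: "((\<lambda>t. sin (u + t)) has_real_derivative c) (at t)"
      and d_cos: "((\<lambda>t. cos (u + t)) has_real_derivative - p) (at t)"
      by (auto intro!: derivative_eq_intros simp: p_def c_def)
    have d_1: "((\<lambda>t. sin t * ln (sin t)) has_real_derivative cos t * l1 + cos t) (at t)"
      and d_2: "((\<lambda>t. sin (d - t) * ln (sin (d - t))) has_real_derivative - cos (d - t) * l2 - cos (d - t)) (at t)"
      and d_ln: "((\<lambda>t. ln (sin (u + t))) has_real_derivative c / p) (at t)"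
      using st p by (auto intro!: derivative_eq_intros simp: l1_def l2_def p_def c_def)
    have p0: "sin (u + t) \<noteq> 0" using p by (simp add: p_def)
    have "(F has_real_derivative
        - L * ((- p * p - c * c) / (p * p)) + 2 + k * (c / p)
        - ((cos t * l1 + cos t) * p - sin t * l1 * c) / (p * p) / su
        + ((- cos (d - t) * l2 - cos (d - t)) * p - sin (d - t) * l2 * c) / (p * p) / sv) (at t)"
      unfolding F_def[abs_def]
      using DERIV_add[OF DERIV_diff[OF DERIV_add[OF DERIV_add[OF
        DERIV_cmult[OF DERIV_divide[OF d_cos d_sin p0], of "- L"] DERIV_cmult_Id[of 2]] DERIV_cmult[OF d_ln, of k]]
        DERIV_cdivide[OF DERIV_divide[OF d_1 d_sin p0], of su]] DERIV_cdivide[OF DERIV_divide[OF d_2 d_sin p0], of sv]]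
      unfolding l1_def l2_def p_def c_def .
    also have "(- p * p - c * c) / (p * p) = - 1 / p\<^sup>2"
    proof -
      have "- p * p - c * c = - 1" using sq(3) by (simp add: power2_eq_square)
      then show ?thesis by (simp add: power2_eq_square)
    qed
    also have "((cos t * l1 + cos t) * p - sin t * l1 * c) / (p * p) / su = l1 / p\<^sup>2 + cu / su * (c / p) + 1"
    proof -
      have "(cos t * l1 + cos t) * p - sin t * l1 * c = su * l1 + (c * cu + p * su) * p"
        using sq(3) unfolding trig by algebra
      then show ?thesis
        using p spos by (simp add: add_divide_distrib power2_eq_square distrib_right mult_ac)
    qed
    also have "((- cos (d - t) * l2 - cos (d - t)) * p - sin (d - t) * l2 * c) / (p * p) / sv
        = - (l2 / p\<^sup>2) - cv / sv * (c / p) - 1"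
    proof -
      have "(- cos (d - t) * l2 - cos (d - t)) * p - sin (d - t) * l2 * c = - sv * l2 - (cv * c + sv * p) * p"
        using sq(3) unfolding trig by algebra
      then show ?thesis
        using p spos by (simp add: add_divide_distrib diff_divide_distrib power2_eq_square distrib_right mult_ac)
    qed
    also have "- L * (- 1 / p\<^sup>2) + 2 + k * (c / p) - (l1 / p\<^sup>2 + cu / su * (c / p) + 1)
        + (- (l2 / p\<^sup>2) - cv / sv * (c / p) - 1) = (L - (l1 + l2)) / p\<^sup>2"
      by (simp add: k_def add_divide_distrib diff_divide_distrib distrib_right)
    also have "\<dots> = kern d u t"
      using st spos by (simp add: kern_def L_def l1_def l2_def p_def su_def sv_def ln_mult)
    finally show "(F has_vector_derivative kern d u t) (at t)"
      by (simp add: has_real_derivative_iff_has_vector_derivative)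
  qed (use assms in auto)
  then have "(kern d u has_integral F d - F 0) {0<..<d}"
    by (simp add: has_integral_Icc_iff_Ioo)
  then have "(LINT t:{0<..<d}|lborel. kern d u t) = F d - F 0"
    using int by (simp add: set_borel_integral_eq_integral integral_unique)
  also have "\<dots> = fibre_integral d u"
  proof -
    have sd: "sin d = sv * cu - cv * su"
      using sin_diff[of "u + d" u] by (simp add: sv_def cu_def cv_def su_def)
    have "F d = - L * (cv / sv) + 2 * d + k * ln sv - sin d * ln (sin d) / sv / su"
      and "F 0 = - L * (cu / su) + k * ln su + sin d * ln (sin d) / su / sv"
      unfolding F_def sv_def cv_def su_def cu_def by simp_all
    moreover have "2 * (sin d / (su * sv)) * ln (sin d)
        = sin d * ln (sin d) / sv / su + sin d * ln (sin d) / su / sv"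
      by (simp add: mult_ac)
    ultimately have "F d - F 0 = 2 * d + L * (cu / su - cv / sv) + k * (ln sv - ln su)
        - 2 * (sin d / (su * sv)) * ln (sin d)"
      by (simp only: right_diff_distrib)
    also have "sin d / (su * sv) = cu / su - cv / sv"
      unfolding sd using spos by (simp add: field_simps)
    finally show ?thesis
      using spos unfolding fibre_integral_def cot_def su_def[symmetric] sv_def[symmetric] cu_def[symmetric] cv_def[symmetric]
      by (simp add: L_def k_def ln_div ln_mult diff_divide_distrib algebra_simps)
  qed
  finally show ?thesis .
qed

lemma kern_integrable_rectangle:
  assumes "0 < d" "d \<le> 1" "0 < s" "s \<le> c" "c + d < pi"
  shows "integrable (lborel \<Otimes>\<^sub>M lborel)
    (\<lambda>(t, u). indicator {0<..<d} t * (indicator {s<..<c} u * kern d u t))"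
proof -
  obtain C where C: "\<And>u t. s \<le> u \<Longrightarrow> u \<le> c \<Longrightarrow> 0 < t \<Longrightarrow> t < d \<Longrightarrow>
    \<bar>kern d u t\<bar> \<le> C * (1 + \<bar>ln (sin t)\<bar> + \<bar>ln (sin (d - t))\<bar>)"
    using kern_bound[of d s c] assms by metis
  define h where "h t = C * (1 + \<bar>ln (sin t)\<bar> + \<bar>ln (sin (d - t))\<bar>)" for t
  have [measurable]: "h \<in> borel_measurable borel"
    unfolding h_def by measurable
  have h: "integrable lborel (\<lambda>t. indicator {0<..<d} t * h t)"
    using kern_majorant_integrable[OF assms(1,2), of C] unfolding set_integrable_def h_def by simp
  have "integrable (lborel \<Otimes>\<^sub>M lborel)
      (\<lambda>(t, u). (indicator {0<..<d} t * h t) * indicator {s<..<c} u)"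
  proof (rule lborel_pair.Fubini_integrable)
    show "integrable lborel (\<lambda>t. \<integral>u. norm (case (t, u) of (t, u) \<Rightarrow>
        (indicator {0<..<d} t * h t) * indicator {s<..<c} u) \<partial>lborel)"
      using integrable_abs[OF h] by (simp add: abs_mult)
    have "integrable lborel (indicat_real {s<..<c})"
      using set_integrable_const_Ioo[of s c 1] unfolding set_integrable_def by simp
    then show "AE t in lborel. integrable lborel (\<lambda>u. case (t, u) of (t, u) \<Rightarrow>
        (indicator {0<..<d} t * h t) * indicator {s<..<c} u)"
      by simp
  qed simp
  then show ?thesis
  proof (rule Bochner_Integration.integrable_bound)
    show "AE p in lborel \<Otimes>\<^sub>M lborel.
      norm (case p of (t, u) \<Rightarrow> indicator {0<..<d} t * (indicator {s<..<c} u * kern d u t))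
        \<le> norm (case p of (t, u) \<Rightarrow> (indicator {0<..<d} t * h t) * indicator {s<..<c} u)"
      using C by (auto intro!: AE_I2 simp: indicator_def h_def intro: order_trans[OF _ abs_ge_self])
  qed measurable
qed

text \<open>
  The inner integral runs to \<open>\<pi>/2 - t\<close>, which may lie on either side of the symmetry axis \<open>m\<close>. It is
  the sum of the integral \<open>N\<close> up to \<open>m\<close> and a signed remainder \<open>E\<close>, and \<open>E\<close> is odd under \<open>t \<mapsto> d - t\<close>.
\<close>
lemma kern_double_integral:
  assumes "0 < d" "d \<le> 1" "0 < s" "s + d < pi / 2"
  defines "m \<equiv> (pi - d) / 2"
  defines "J \<equiv> \<lambda>t. LBINT u=s..pi/2-t. kern d u t"
  shows "set_integrable lborel {0<..<d} J"
    and "(LINT t:{0<..<d}|lborel. J t) = (LBINT u=s..m. fibre_integral d u)"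
proof -
  have m: "s < m" "m < pi / 2" "m + d < pi"
    using assms pi_gt3 by (auto simp: m_def field_simps)
  define N where "N t = (LBINT u=s..m. kern d u t)" for t
  define E where "E t = (LBINT u=m..pi/2-t. kern d u t)" for t
  let ?F = "\<lambda>c (t, u). indicator {0<..<d} t * (indicator {s<..<c} u * kern d u t) :: real"
  have F: "integrable (lborel \<Otimes>\<^sub>M lborel) (?F c)" if "s \<le> c" "c + d < pi" for c
    using kern_integrable_rectangle assms(1-3) that by blast
  have kern_int: "interval_lebesgue_integrable lborel (ereal x) (ereal y) (\<lambda>u. kern d u t)"
    if "0 < x" "x \<le> y" "y + d < pi" "0 < t" "t < d" for x y t
    using that assms pi_gt3 by (intro interval_integrable_continuous_on continuous_on_kern) auto

  \<comment> \<open>As \<open>\<pi>/2 + d < \<pi>\<close>, the kernel is integrable on a rectangle that contains the whole domain.\<close>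
  have J_int: "set_integrable lborel {0<..<d} J"
  proof -
    have "{p::real \<times> real. snd p < pi / 2 - fst p} \<in> sets (borel \<Otimes>\<^sub>M borel)"
      unfolding borel_prod by (intro borel_open open_Collect_less continuous_intros)
    then have "integrable (lborel \<Otimes>\<^sub>M lborel)
        (\<lambda>p. indicator {p. snd p < pi / 2 - fst p} p *\<^sub>R ?F (pi / 2) p)"
      using assms pi_gt3 by (intro integrable_mult_indicator F) auto
    from lborel_pair.integrable_fst'[OF this]
    have "integrable lborel (\<lambda>t. \<integral>u. indicator {p. snd p < pi / 2 - fst p} (t, u) *\<^sub>R ?F (pi / 2) (t, u) \<partial>lborel)" .
    also have "(\<lambda>t. \<integral>u. indicator {p. snd p < pi / 2 - fst p} (t, u) *\<^sub>R ?F (pi / 2) (t, u) \<partial>lborel)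
        = (\<lambda>t. indicator {0<..<d} t *\<^sub>R J t)"
    proof
      fix t
      show "(\<integral>u. indicator {p. snd p < pi / 2 - fst p} (t, u) *\<^sub>R ?F (pi / 2) (t, u) \<partial>lborel)
          = indicator {0<..<d} t *\<^sub>R J t"
      proof (cases "t \<in> {0<..<d}")
        case True
        then have "s \<le> pi / 2 - t" using assms by auto
        then have "J t = (\<integral>u. indicator {s<..<pi/2-t} u *\<^sub>R kern d u t \<partial>lborel)"
          by (simp add: J_def interval_lebesgue_integral_def set_lebesgue_integral_def)
        also have "(\<lambda>u. indicator {s<..<pi/2-t} u *\<^sub>R kern d u t) =
            (\<lambda>u. indicator {p. snd p < pi / 2 - fst p} (t, u) *\<^sub>R ?F (pi / 2) (t, u))"
          using True by (auto simp: fun_eq_iff indicator_def)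
        finally show ?thesis using True by simp
      qed simp
    qed
    finally show ?thesis
      unfolding set_integrable_def .
  qed
  then show "set_integrable lborel {0<..<d} J" .

  have N_eq: "(\<integral>u. ?F m (t, u) \<partial>lborel) = indicator {0<..<d} t *\<^sub>R N t" for t
    using m by (simp add: N_def interval_lebesgue_integral_def set_lebesgue_integral_def)
  have N_int: "set_integrable lborel {0<..<d} N"
    using lborel_pair.integrable_fst'[OF F[of m]] m unfolding N_eq set_integrable_def by simp

  have "(LINT t:{0<..<d}|lborel. N t) = (\<integral>t. \<integral>u. ?F m (t, u) \<partial>lborel \<partial>lborel)"
    unfolding N_eq set_lebesgue_integral_def ..
  also have "\<dots> = (\<integral>u. \<integral>t. ?F m (t, u) \<partial>lborel \<partial>lborel)"
    using lborel_pair.Fubini_integral[of "\<lambda>t u. ?F m (t, u)"] F[of m] m by simp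
  also have "\<dots> = (\<integral>u. indicator {s<..<m} u *\<^sub>R fibre_integral d u \<partial>lborel)"
  proof (rule Bochner_Integration.integral_cong[OF refl])
    fix u
    have "(\<integral>t. ?F m (t, u) \<partial>lborel) = indicator {s<..<m} u * (LINT t:{0<..<d}|lborel. kern d u t)"
      by (simp add: set_lebesgue_integral_def mult.left_commute[of "indicator {0<..<d} _"])
    then show "(\<integral>t. ?F m (t, u) \<partial>lborel) = indicator {s<..<m} u *\<^sub>R fibre_integral d u"
      using kern_integral_fibre[OF assms(1,2), of u] assms m by (auto simp: indicator_def)
  qed
  also have "\<dots> = (LBINT u=s..m. fibre_integral d u)"
    using m by (simp add: interval_lebesgue_integral_def set_lebesgue_integral_def)
  finally have N_val: "(LINT t:{0<..<d}|lborel. N t) = (LBINT u=s..m. fibre_integral d u)" .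

  have J_eq: "J t = N t + E t" if "t \<in> {0<..<d}" for t
    unfolding J_def N_def E_def
    using that assms m by (intro interval_integral_sum[symmetric])
      (auto simp: min_def max_def intro!: kern_int)
  have "set_integrable lborel {0<..<d} (\<lambda>t. J t - N t)"
    by (rule set_integral_diff(1)[OF J_int N_int])
  then have E_int: "set_integrable lborel {0<..<d} E"
    by (rule set_integrable_cong[THEN iffD1, rotated -1]) (auto simp: J_eq)
  have E_odd: "E (d - t) = - E t" for t
  proof -
    have "kern d u (d - t) = kern d (pi - d - u) t" for u
      using kern_reflect[of d u "d - t"] by simp
    then have "E (d - t) = (LBINT u=m..pi/2-(d-t). kern d (pi - d - u) t)"
      unfolding E_def by simp
    also have "\<dots> = (LBINT u=(pi-d)-(pi/2-(d-t))..(pi-d)-m. kern d u t)"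
      by (rule interval_integral_minus_argument)
    also have "(pi-d)-(pi/2-(d-t)) = pi/2-t" by simp
    also have "(pi-d)-m = m" by (simp add: m_def field_simps)
    finally show ?thesis
      unfolding E_def by (simp add: interval_integral_endpoints_reverse[of "ereal (pi/2-t)"])
  qed
  have "(LINT t:{0<..<d}|lborel. \<bar>-1\<bar> * E (d - t)) = (LINT t:{0<..<d}|lborel. E t)"
  proof (rule set_integral_substitution_inj(2)[OF _ _ _ _ _ _ _ E_int])
    show "(\<lambda>t. d - t) ` {0<..<d} = {0<..<d}"
      by (rule image_minus_Ioo)
  qed (auto simp: inj_on_def intro!: derivative_eq_intros)
  then have E_val: "(LINT t:{0<..<d}|lborel. E t) = 0"
    by (simp add: E_odd set_lebesgue_integral_def)
  have "(LINT t:{0<..<d}|lborel. J t) = (LINT t:{0<..<d}|lborel. N t + E t)"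
    by (rule set_lebesgue_integral_cong) (auto simp: J_eq)
  also have "\<dots> = (LBINT u=s..m. fibre_integral d u)"
    using set_integral_add(2)[OF N_int E_int] by (simp add: N_val E_val)
  finally show "(LINT t:{0<..<d}|lborel. J t) = (LBINT u=s..m. fibre_integral d u)" .
qed

lemma fibre_integral_eq_dilog:
  assumes "0 < d" "0 < s" "s \<le> (pi - d) / 2"
  shows "(LBINT u=s..(pi - d) / 2. fibre_integral d u)
    = 2 * Re (rogers_dilog (dilog_point d s) - rogers_dilog (1 / dilog_point d s))"
proof -
  define m where "m = (pi - d) / 2"
  define G where "G u = - (2 * Re (rogers_dilog (dilog_point d u) - rogers_dilog (1 / dilog_point d u)))" for u
  have m: "s \<le> m" "m + d < pi" "0 < m" using assms pi_gt_zero by (auto simp: m_def field_simps)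
  have deriv: "(G has_real_derivative fibre_integral d u) (at u)" if "s \<le> u" "u \<le> m" for u
  proof -
    have "((\<lambda>u. 2 * Re (rogers_dilog (dilog_point d u) - rogers_dilog (1 / dilog_point d u)))
        has_real_derivative - fibre_integral d u) (at u)"
      using that assms m by (intro has_real_derivative_dilog_difference) auto
    from DERIV_minus[OF this] show ?thesis
      unfolding G_def minus_minus .
  qed
  have "(LBINT u=s..m. fibre_integral d u) = G m - G s"
  proof (rule interval_integral_FTC_finite)
    have "sin u > 0" "sin (u + d) > 0" if "s \<le> u" "u \<le> m" for u
      using that assms m by (auto intro!: sin_gt_zero)
    then have ne: "sin u = 0 \<Longrightarrow> s \<le> u \<Longrightarrow> u \<le> m \<Longrightarrow> False"
      "sin (u + d) = 0 \<Longrightarrow> s \<le> u \<Longrightarrow> u \<le> m \<Longrightarrow> False" for u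
      by (metis less_irrefl)+
    have "sin d > 0"
      using assms m by (intro sin_gt_zero) auto
    then have "continuous_on {s..m} (\<lambda>u. 2 * d + 2 * (cos u / sin u) * ln (sin (u + d) / sin d)
        - 2 * (cos (u + d) / sin (u + d)) * ln (sin u / sin d))"
      by (intro continuous_intros) (auto dest: ne)
    then show "continuous_on {min s m..max s m} (fibre_integral d)"
      using m unfolding fibre_integral_def cot_def by (simp add: min_def max_def)
  next
    fix u assume "min s m \<le> u" "u \<le> max s m"
    then have "s \<le> u" "u \<le> m" using m by auto
    from deriv[OF this] show "(G has_vector_derivative fibre_integral d u) (at u within {min s m..max s m})"
      unfolding has_real_derivative_iff_has_vector_derivative by (rule has_vector_derivative_at_within)
  qed
  \<comment> \<open>At \<open>m\<close> the point has modulus \<open>1\<close>, so it is conjugate to its inverse.\<close>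
  moreover have "G m = 0"
  proof -
    have "m + d = pi - m" by (simp add: m_def field_simps)
    then have "sin (m + d) = sin m" using sin_pi_minus[of m] by metis
    moreover have "sin m > 0" "sin d > 0" using m assms by (auto intro!: sin_gt_zero)
    ultimately have "dilog_point d m = cis (- d)" "1 / dilog_point d m = cnj (cis (- d))"
      unfolding inverse_dilog_point by (simp_all add: dilog_point_def cis_cnj)
    then show ?thesis
      unfolding G_def using rogers_dilog_cnj[of "cis (- d)"] \<open>sin d > 0\<close> by fastforce
  qed
  ultimately show ?thesis
    by (simp add: G_def m_def)
qed

section \<open>Passage to angular coordinates\<close>

lemma tan_minus_tan:
  fixes x y :: real
  assumes "cos x \<noteq> 0" "cos y \<noteq> 0"
  shows "tan x - tan y = sin (x - y) / (cos x * cos y)"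
  using assms by (simp add: tan_def sin_diff field_simps)

lemma tan_squared_plus_1:
  fixes x :: real
  assumes "cos x \<noteq> 0"
  shows "(tan x)\<^sup>2 + 1 = 1 / (cos x)\<^sup>2"
  using tan_sec[of x] assms by (simp add: power_inverse field_simps)

lemma I_integrand_tan:
  fixes \<alpha> d u t :: real
  assumes "0 < t" "t < d" "0 < u" "u + d < pi"
    and cos_pos: "cos \<alpha> > 0" "cos (\<alpha> + d) > 0" "cos (\<alpha> - u) > 0" "cos (\<alpha> + t) > 0"
  shows "I_integrand (tan \<alpha>) (tan (\<alpha> + d)) (tan (\<alpha> - u)) (tan (\<alpha> + t))
    = (cos (\<alpha> - u))\<^sup>2 * (cos (\<alpha> + t))\<^sup>2 * kern d u t"
proof -
  define X Y where "X = cos (\<alpha> - u)" and "Y = cos (\<alpha> + t)"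
  have pos: "sin u > 0" "sin (u + d) > 0" "sin t > 0" "sin (d - t) > 0" "sin (u + t) > 0" "X > 0" "Y > 0"
    using assms by (auto intro!: sin_gt_zero simp: X_def Y_def)
  have "tan (\<alpha> - u) - tan \<alpha> = - sin u / (X * cos \<alpha>)"
    using cos_pos by (simp add: tan_minus_tan X_def)
  moreover have "tan (\<alpha> - u) - tan (\<alpha> + d) = - sin (u + d) / (X * cos (\<alpha> + d))"
    using cos_pos sin_minus[of "u + d"] by (simp add: tan_minus_tan X_def algebra_simps)
  moreover have "tan (\<alpha> + t) - tan \<alpha> = sin t / (Y * cos \<alpha>)"
    using cos_pos by (simp add: tan_minus_tan Y_def)
  moreover have "tan (\<alpha> + t) - tan (\<alpha> + d) = - sin (d - t) / (Y * cos (\<alpha> + d))"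
    using cos_pos sin_minus[of "d - t"] by (simp add: tan_minus_tan Y_def algebra_simps)
  moreover have "tan (\<alpha> + t) - tan (\<alpha> - u) = sin (u + t) / (Y * X)"
    using cos_pos by (simp add: tan_minus_tan X_def Y_def add.commute)
  moreover have "(tan (\<alpha> - u))\<^sup>2 + 1 = 1 / X\<^sup>2" "(tan (\<alpha> + t))\<^sup>2 + 1 = 1 / Y\<^sup>2"
    using cos_pos by (simp_all add: tan_squared_plus_1 X_def Y_def)
  ultimately have eq: "I_integrand (tan \<alpha>) (tan (\<alpha> + d)) (tan (\<alpha> - u)) (tan (\<alpha> + t)) =
     ln \<bar>((- sin u / (X * cos \<alpha>)) * (- sin (u + d) / (X * cos (\<alpha> + d))) * (1 / Y\<^sup>2)) /
        ((sin t / (Y * cos \<alpha>)) * (- sin (d - t) / (Y * cos (\<alpha> + d))) * (1 / X\<^sup>2))\<bar> / (sin (u + t) / (Y * X))\<^sup>2"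
    unfolding I_integrand_def by simp
  have "((- sin u / (X * cos \<alpha>)) * (- sin (u + d) / (X * cos (\<alpha> + d))) * (1 / Y\<^sup>2)) /
        ((sin t / (Y * cos \<alpha>)) * (- sin (d - t) / (Y * cos (\<alpha> + d))) * (1 / X\<^sup>2))
      = - ((sin u * sin (u + d)) / (sin t * sin (d - t)))"
    using pos cos_pos by (simp add: power2_eq_square)
  also have "\<bar>\<dots>\<bar> = (sin u * sin (u + d)) / (sin t * sin (d - t))"
    using pos by simp
  finally have "I_integrand (tan \<alpha>) (tan (\<alpha> + d)) (tan (\<alpha> - u)) (tan (\<alpha> + t)) =
      ln ((sin u * sin (u + d)) / (sin t * sin (d - t))) / (sin (u + t) / (Y * X))\<^sup>2"
    unfolding eq by simp
  also have "ln ((sin u * sin (u + d)) / (sin t * sin (d - t))) =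
      ln (sin u * sin (u + d)) - ln (sin t * sin (d - t))"
    using pos by (simp add: ln_div)
  finally show ?thesis
    by (simp add: kern_def X_def Y_def power_divide power_mult_distrib mult_ac)
qed

lemma continuous_on_I_integrand:
  assumes "0 < a" "a < y" "y < b"
  shows "continuous_on {..<0} (\<lambda>x. I_integrand a b x y)"
proof -
  have "x\<^sup>2 + 1 \<noteq> 0" for x :: real
    using zero_le_power2[of x] by linarith
  then show ?thesis
    unfolding I_integrand_def using assms by (intro continuous_intros) auto
qed

text \<open>
  The factor \<open>(cos (\<alpha> + t))\<^sup>2\<close> is the reciprocal of the Jacobian of \<open>y = tan (\<alpha> + t)\<close>. The limits
  \<open>x = - b\<close> and \<open>x = - 1/y\<close> correspond to \<open>u = 2 \<alpha> + d\<close> and \<open>u = \<pi>/2 - t\<close>.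
\<close>
lemma I_inner_tan:
  fixes \<alpha> d t :: real
  assumes "0 < \<alpha>" "\<alpha> + d < pi / 4" "0 < t" "t < d"
  shows "I_inner (tan \<alpha>) (tan (\<alpha> + d)) (tan (\<alpha> + t)) =
    (cos (\<alpha> + t))\<^sup>2 * (LBINT u=2*\<alpha>+d..pi/2-t. kern d u t)"
proof -
  let ?a = "tan \<alpha>" and ?b = "tan (\<alpha> + d)" and ?y = "tan (\<alpha> + t)"
  define s where "s = 2 * \<alpha> + d"
  define g g' where "g u = tan (\<alpha> - u)" and "g' u = - inverse ((cos (\<alpha> - u))\<^sup>2)" for u
  have s: "0 < s" "s \<le> pi / 2 - t" using assms by (auto simp: s_def)
  have cos_pos: "cos (\<alpha> - u) > 0" if "u \<in> {s..pi/2-t}" for u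
    using that assms by (intro cos_gt_zero_pi) (auto simp: s_def)
  then have cos_ne: "cos (\<alpha> - u) \<noteq> 0" if "u \<in> {s..pi/2-t}" for u
    using that by (metis less_irrefl)
  have cos_pos': "cos \<alpha> > 0" "cos (\<alpha> + d) > 0" "cos (\<alpha> + t) > 0"
    using assms by (auto intro!: cos_gt_zero_pi)
  have ordered: "0 < ?a" "?a < ?y" "?y < ?b"
    using assms by (auto intro!: tan_gt_zero tan_monotone)
  have "(LBINT u=s..pi/2-t. g' u *\<^sub>R I_integrand ?a ?b (g u) ?y) =
      (LBINT x=g s..g (pi/2-t). I_integrand ?a ?b x ?y)"
  proof (rule interval_integral_substitution_finite)
    show "(g has_real_derivative g' u) (at u within {s..pi/2-t})"
      if "s \<le> u" "u \<le> pi/2-t" for u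
      using cos_pos[of u] that unfolding g_def g'_def
      by (auto intro!: derivative_eq_intros)
    have "g u < 0" if "u \<in> {s..pi/2-t}" for u
      using that assms tan_gt_zero[of "u - \<alpha>"] tan_minus[of "u - \<alpha>"] by (auto simp: g_def s_def)
    then show "continuous_on (g ` {s..pi/2-t}) (\<lambda>x. I_integrand ?a ?b x ?y)"
      by (intro continuous_on_subset[OF continuous_on_I_integrand]) (use ordered in auto)
    show "continuous_on {s..pi/2-t} g'"
      unfolding g'_def using cos_ne by (intro continuous_intros) auto
  qed (use s in auto)
  also have "g s = - ?b"
    using tan_minus[of "\<alpha> + d"] by (simp add: g_def s_def)
  also have "g (pi/2-t) = - 1 / ?y"
  proof -
    have "g (pi/2-t) = - tan (pi / 2 - (\<alpha> + t))"
      using tan_minus[of "pi / 2 - (\<alpha> + t)"] by (simp add: g_def algebra_simps)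
    then show ?thesis by (simp add: tan_cot inverse_eq_divide)
  qed
  finally have "(LBINT x=-?b..-1/?y. I_integrand ?a ?b x ?y)
      = (LBINT u=s..pi/2-t. g' u *\<^sub>R I_integrand ?a ?b (g u) ?y)" by simp
  also have "\<dots> = (LBINT u=s..pi/2-t. - ((cos (\<alpha> + t))\<^sup>2 * kern d u t))"
  proof (rule interval_integral_cong)
    fix u assume "u \<in> einterval (min (ereal s) (ereal (pi/2-t))) (max (ereal s) (ereal (pi/2-t)))"
    then have u: "s < u" "u < pi / 2 - t"
      using s by (auto simp: min_def max_def einterval_iff split: if_splits)
    have "I_integrand ?a ?b (g u) ?y = (cos (\<alpha> - u))\<^sup>2 * (cos (\<alpha> + t))\<^sup>2 * kern d u t"
      unfolding g_def using u s assms cos_pos[of u] cos_pos' by (intro I_integrand_tan) auto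
    then show "g' u *\<^sub>R I_integrand ?a ?b (g u) ?y = - ((cos (\<alpha> + t))\<^sup>2 * kern d u t)"
      using cos_pos[of u] u by (simp add: g'_def)
  qed
  also have "\<dots> = - ((cos (\<alpha> + t))\<^sup>2 * (LBINT u=s..pi/2-t. kern d u t))"
    by (simp add: interval_lebesgue_integral_uminus)
  finally show ?thesis
    unfolding I_inner_def s_def
    by (subst interval_integral_endpoints_reverse) simp
qed

text \<open>
  By the addition theorem \<open>(1 - a b) / (a + b) = cot (\<alpha> + \<beta>)\<close> and \<open>(1 - b\<^sup>2) / (2 b) = cot (2 \<beta>)\<close>,
  while \<open>cot x + \<i> = cis x / sin x\<close>.
\<close>
lemma dilog_point_eq_cot_quotient:
  fixes \<alpha> \<beta> :: real
  assumes "0 < \<alpha>" "\<alpha> < \<beta>" "\<beta> < pi / 4"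
  defines "a \<equiv> tan \<alpha>" and "b \<equiv> tan \<beta>"
  shows "dilog_point (\<beta> - \<alpha>) (\<alpha> + \<beta>) =
    (of_real ((1 - a * b) / (a + b)) + \<i>) / (of_real ((1 - b\<^sup>2) / (2 * b)) + \<i>)"
proof -
  have cot_plus_i: "of_real (cos x / sin x) + \<i> = cis x / of_real (sin x)" if "sin x \<noteq> 0" for x
    using that by (auto simp: complex_eq_iff Re_divide_of_real Im_divide_of_real)
  have cot_sum: "(1 - tan x * tan y) / (tan x + tan y) = cos (x + y) / sin (x + y)"
    if "0 < x" "x < pi / 2" "0 < y" "y < pi / 2" for x y :: real
  proof -
    have "cos x > 0" "cos y > 0" using that by (auto intro!: cos_gt_zero)
    then have "1 - tan x * tan y = cos (x + y) / (cos x * cos y)"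
      "tan x + tan y = sin (x + y) / (cos x * cos y)"
      by (simp_all add: tan_def cos_add sin_add field_simps)
    then show ?thesis
      using \<open>cos x > 0\<close> \<open>cos y > 0\<close> by simp
  qed
  have pos: "sin (\<alpha> + \<beta>) > 0" "sin (\<beta> + \<beta>) > 0"
    using assms by (auto intro!: sin_gt_zero)
  have "(1 - a * b) / (a + b) = cos (\<alpha> + \<beta>) / sin (\<alpha> + \<beta>)"
    unfolding a_def b_def using assms by (intro cot_sum) auto
  moreover have "(1 - b\<^sup>2) / (2 * b) = cos (\<beta> + \<beta>) / sin (\<beta> + \<beta>)"
    using cot_sum[of \<beta> \<beta>] assms by (simp add: b_def power2_eq_square)
  moreover have "dilog_point (\<beta> - \<alpha>) (\<alpha> + \<beta>) =
      (cis (\<alpha> + \<beta>) / of_real (sin (\<alpha> + \<beta>))) / (cis (\<beta> + \<beta>) / of_real (sin (\<beta> + \<beta>)))"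
  proof -
    have "dilog_point (\<beta> - \<alpha>) (\<alpha> + \<beta>) =
        of_real (sin (\<beta> + \<beta>) / sin (\<alpha> + \<beta>)) * (cis (\<alpha> + \<beta>) / cis (\<beta> + \<beta>))"
      unfolding dilog_point_def cis_divide by (simp add: algebra_simps)
    then show ?thesis by simp
  qed
  ultimately show ?thesis
    using pos by (simp only: cot_plus_i less_imp_neq[symmetric] not_False_eq_True)
qed

theorem lemma6p4:
  fixes a b :: real and z :: complex
  assumes "0 < a" and "a < b" and "b < 1"
    and "z = (of_real ((1 - a * b) / (a + b)) + \<i>) / (of_real ((1 - b\<^sup>2) / (2 * b)) + \<i>)"
  shows "(\<forall>y. a < y \<and> y < b \<longrightarrow>
            interval_lebesgue_integrable lborel (ereal (- 1 / y)) (ereal (- b))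
              (\<lambda>x. I_integrand a b x y))
       \<and> interval_lebesgue_integrable lborel (ereal a) (ereal b) (I_inner a b)
       \<and> of_real (I_integral a b)
           = rogers_dilog z + rogers_dilog (cnj z) - rogers_dilog (1 / z) - rogers_dilog (1 / cnj z)
       \<and> rogers_dilog z + rogers_dilog (cnj z) - rogers_dilog (1 / z) - rogers_dilog (1 / cnj z)
           = of_real (2 * Re (rogers_dilog z - rogers_dilog (1 / z)))"
proof -
  define \<alpha> \<beta> where "\<alpha> = arctan a" and "\<beta> = arctan b"
  define d s where "d = \<beta> - \<alpha>" and "s = \<alpha> + \<beta>"
  have tan_eqs: "tan \<alpha> = a" "tan \<beta> = b" "tan (\<alpha> + d) = b"
    by (simp_all add: \<alpha>_def \<beta>_def d_def tan_arctan)
  have angles: "0 < \<alpha>" "\<alpha> < \<beta>" "\<beta> < pi / 4"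
    using assms arctan_less_iff[of b 1] by (auto simp: \<alpha>_def \<beta>_def arctan_one arctan_less_iff)
  have ds: "0 < d" "d \<le> 1" "0 < s" "s + d < pi / 2" "s \<le> (pi - d) / 2"
    using angles pi_less_4 by (auto simp: d_def s_def)
  have z: "z = dilog_point d s"
    using dilog_point_eq_cot_quotient[OF angles] assms(4) by (simp add: tan_eqs d_def s_def)
  have sin_pos: "sin s > 0" "sin (s + d) > 0" "sin d > 0"
    using ds by (auto intro!: sin_gt_zero)
  have Im_z: "Im z \<noteq> 0" "Im (1 / z) \<noteq> 0"
    unfolding z inverse_dilog_point using sin_pos by (simp_all add: dilog_point_def)

  \<comment> \<open>The outer substitution is \<open>t = arctan y - \<alpha>\<close>, with derivative \<open>1 / (1 + y\<^sup>2) = cos\<^sup>2 (arctan y)\<close>.\<close>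
  define J where "J t = (LBINT u=s..pi/2-t. kern d u t)" for t
  define g where "g y = arctan y - \<alpha>" for y
  have inner: "I_inner a b y = \<bar>inverse (1 + y\<^sup>2)\<bar> * J (g y)" if "y \<in> {a<..<b}" for y
  proof -
    have "0 < g y" "g y < d"
      using that by (auto simp: g_def d_def \<alpha>_def \<beta>_def arctan_less_iff)
    moreover have "tan (\<alpha> + g y) = y" "\<alpha> + g y = arctan y"
      by (simp_all add: g_def tan_arctan)
    ultimately have "I_inner a b y = (cos (arctan y))\<^sup>2 * J (g y)"
      using I_inner_tan[of \<alpha> d "g y"] angles tan_eqs by (simp add: J_def s_def d_def algebra_simps)
    also have "(cos (arctan y))\<^sup>2 = \<bar>inverse (1 + y\<^sup>2)\<bar>"
      by (simp add: cos_arctan power_divide inverse_eq_divide)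
    finally show ?thesis .
  qed
  have J: "set_integrable lborel {0<..<d} J"
    "(LINT t:{0<..<d}|lborel. J t) = 2 * Re (rogers_dilog z - rogers_dilog (1 / z))"
    using kern_double_integral[of d s] fibre_integral_eq_dilog[of d s] ds
    unfolding J_def z by simp_all
  have image: "g ` {a<..<b} = {0<..<d}"
  proof safe
    fix t assume t: "t \<in> {0<..<d}"
    then have "tan \<alpha> < tan (\<alpha> + t)" "tan (\<alpha> + t) < tan \<beta>"
      using angles by (auto intro!: tan_monotone simp: d_def)
    moreover have "arctan (tan (\<alpha> + t)) = \<alpha> + t"
      using t angles by (intro arctan_tan) (auto simp: d_def)
    ultimately show "t \<in> g ` {a<..<b}"
      by (intro image_eqI[of _ _ "tan (\<alpha> + t)"]) (auto simp: g_def tan_eqs)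
  qed (auto simp: g_def d_def \<alpha>_def \<beta>_def arctan_less_iff)
  have deriv: "(g has_real_derivative inverse (1 + y\<^sup>2)) (at y)" for y
    unfolding g_def by (auto intro!: derivative_eq_intros)
  have inj: "inj_on g {a<..<b}"
    by (auto simp: inj_on_def g_def arctan_eq_iff)
  have meas: "g \<in> borel_measurable borel" "(\<lambda>y::real. inverse (1 + y\<^sup>2)) \<in> borel_measurable borel"
    unfolding g_def by measurable
  note subst = set_integral_substitution_inj[OF _ _ image inj deriv meas J(1)]
  have outer_integrable: "set_integrable lborel {a<..<b} (I_inner a b)"
    using subst(1) by (rule set_integrable_cong[THEN iffD1, rotated -1]) (auto simp: inner)
  have "I_integral a b = (LINT y:{a<..<b}|lborel. I_inner a b y)"
    using assms by (simp add: I_integral_def interval_lebesgue_integral_def)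
  also have "\<dots> = (LINT y:{a<..<b}|lborel. \<bar>inverse (1 + y\<^sup>2)\<bar> * J (g y))"
    by (rule set_lebesgue_integral_cong) (auto simp: inner)
  also have "\<dots> = 2 * Re (rogers_dilog z - rogers_dilog (1 / z))"
    using subst(2) J(2) by simp
  finally have I_eq: "I_integral a b = 2 * Re (rogers_dilog z - rogers_dilog (1 / z))" .

  have "rogers_dilog (cnj z) = cnj (rogers_dilog z)" "rogers_dilog (1 / cnj z) = cnj (rogers_dilog (1 / z))"
    using rogers_dilog_cnj[OF Im_z(1)] rogers_dilog_cnj[OF Im_z(2)] by simp_all
  then have sum_eq: "rogers_dilog z + rogers_dilog (cnj z) - rogers_dilog (1 / z) - rogers_dilog (1 / cnj z)
      = of_real (2 * Re (rogers_dilog z - rogers_dilog (1 / z)))"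
    by (simp add: complex_eq_iff)

  have "interval_lebesgue_integrable lborel (ereal (- 1 / y)) (ereal (- b)) (\<lambda>x. I_integrand a b x y)"
    if "a < y" "y < b" for y
  proof (rule interval_integrable_continuous_on)
    have "b * y \<le> 1 * 1" using assms that by (intro mult_mono) auto
    then show "- 1 / y \<le> - b" using assms that by (simp add: field_simps)
    show "continuous_on {- 1 / y..- b} (\<lambda>x. I_integrand a b x y)"
      by (rule continuous_on_subset[OF continuous_on_I_integrand]) (use assms that in auto)
  qed
  moreover have "interval_lebesgue_integrable lborel (ereal a) (ereal b) (I_inner a b)"
    using outer_integrable assms by (simp add: interval_lebesgue_integrable_def)
  ultimately show ?thesis
    using sum_eq I_eq by simp
qed

end
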